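(* Let $\Bbbk$ be an algebraically closed field of characteristic zero, let $h\in\Bbbk[x]$ with $\deg h\ge 1$ be a non-square-free polynomial, let $A_h=\Bbbk[x][t;h(x)\partial_x]$, and set $\psi=\gcd(h,h')$ and $g=h/\psi$. Then: (1) If $\deg g\ge 2$, then a derivation $D\in\mathrm{Der}(A_h)$ is locally finite if and only if $D=D_{p(x)}$ for some $p(x)\in\Bbbk[x]$. In particular, a derivation of $A_h$ is locally finite if and only if it is locally nilpotent. (2) If $\deg g=1$, then a derivation $D\in\mathrm{Der}(A_h)$ is locally finite if and only if $D=\lambda E_t+D_{p(x)}$ for some $\lambda\in\Bbbk$ and $p(x)\in\Bbbk[x]$.
   Context: $A_h=\Bbbk[x][t;h(x)\partial_x]$ is the differential Ore extension, i.e. the associative unital $\Bbbk$-algebra generated by $x,t$ subject to the relation $tx-xt=h(x)$. $\mathrm{Der}(A_h)$ is the set of $\Bbbk$-linear derivations of $A_h$. Non-square-free means $\gcd(h,h')\notin\Bbbk$; the gcd is fixed up to a nonzero scalar, any choice being allowed. For $p(x)\in\Bbbk[x]$, $D_{p(x)}$ is the derivation of $A_h$ determined by $D_{p(x)}(x)=0$ and $D_{p(x)}(t)=p(x)$. $E_t$ is the derivation of $A_h$ given by $E_t(f)=\left[\tfrac1\psi t,f\right]$ for $f\in A_h$, where the commutator $[a,b]=ab-ba$ is computed in the localization $A_h[S^{-1}]$ with $S=\{\psi^n\mid n\ge0\}$; it is known that $E_t$ maps $A_h$ into $A_h$. A derivation $D$ of a $\Bbbk$-algebra $A$ is locally finite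 if for every $a\in A$ the space $\mathrm{Span}_\Bbbk\{D^n(a)\mid n\ge0\}$ is finite-dimensional, and locally nilpotent if for every $a\in A$ there is $n\ge1$ with $D^n(a)=0$. *)

theory Defs
  imports
    "HOL-Computational_Algebra.Polynomial"
    "HOL-Computational_Algebra.Polynomial_Factorial"
begin

section \<open>Differential Ore extensions\<close>

text \<open>
  For a derivation \<open>\<delta>\<close> of a commutative ring \<open>R\<close>, an element \<open>\<Sum> r\<^sub>i t\<^sup>i\<close> of \<open>R[t; \<delta>]\<close>, with the
  coefficients written on the left, is represented by the polynomial with coefficients \<open>r\<^sub>i\<close>.
  Addition, the left \<open>R\<close>-module structure and right multiplication by \<open>t\<close> (which is \<open>pCons 0\<close>) are
  those of the type \<open>R poly\<close>, but the multiplication \<open>(*)\<close> of that type is not used: the product is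
  \<open>ore_mult \<delta>\<close>, determined by \<open>t r = r t + \<delta> r\<close>.
\<close>

definition ore_t_mult :: "('a::comm_ring_1 \<Rightarrow> 'a) \<Rightarrow> 'a poly \<Rightarrow> 'a poly" where
  "ore_t_mult \<delta> g = pCons 0 g + map_poly \<delta> g"

definition ore_mult :: "('a::comm_ring_1 \<Rightarrow> 'a) \<Rightarrow> 'a poly \<Rightarrow> 'a poly \<Rightarrow> 'a poly" where
  "ore_mult \<delta> f g = (\<Sum>i\<le>degree f. smult (coeff f i) ((ore_t_mult \<delta> ^^ i) g))"

definition ore_commutator :: "('a::comm_ring_1 \<Rightarrow> 'a) \<Rightarrow> 'a poly \<Rightarrow> 'a poly \<Rightarrow> 'a poly" where
  "ore_commutator \<delta> a b = ore_mult \<delta> a b - ore_mult \<delta> b a"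

locale ring_derivation =
  fixes \<delta> :: "'a::comm_ring_1 \<Rightarrow> 'a"
  assumes add: "\<delta> (a + b) = \<delta> a + \<delta> b"
    and mult: "\<delta> (a * b) = \<delta> a * b + a * \<delta> b"


section \<open>Derivations of algebras\<close>

text \<open>A \<open>k\<close>-algebra is given by its scalar multiplication \<open>s\<close> and its product \<open>m\<close> on a type.\<close>

definition derivations ::
    "('k::field \<Rightarrow> 'v::ab_group_add \<Rightarrow> 'v) \<Rightarrow> ('v \<Rightarrow> 'v \<Rightarrow> 'v) \<Rightarrow> ('v \<Rightarrow> 'v) set" where
  "derivations s m = {D. Vector_Spaces.linear s s D \<and> (\<forall>a b. D (m a b) = m (D a) b + m a (D b))}"

definition locally_finite ::
    "('k::field \<Rightarrow> 'v::ab_group_add \<Rightarrow> 'v) \<Rightarrow> ('v \<Rightarrow> 'v) \<Rightarrow> bool" where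
  "locally_finite s D \<longleftrightarrow>
     (\<forall>a. \<exists>B. finite B \<and> module.span s B = module.span s {(D ^^ n) a | n. True})"

definition locally_nilpotent :: "('v::zero \<Rightarrow> 'v) \<Rightarrow> bool" where
  "locally_nilpotent D \<longleftrightarrow> (\<forall>a. \<exists>n\<ge>1. (D ^^ n) a = 0)"


section \<open>The algebra \<open>A\<^sub>h\<close>\<close>

definition Ah_scale :: "'k::field \<Rightarrow> 'k poly poly \<Rightarrow> 'k poly poly" where
  "Ah_scale c = smult [:c:]"

definition poly_der :: "'k::field poly \<Rightarrow> 'k poly \<Rightarrow> 'k poly" where
  "poly_der h p = h * pderiv p"

definition Ah_mult :: "'k::field poly \<Rightarrow> 'k poly poly \<Rightarrow> 'k poly poly \<Rightarrow> 'k poly poly" where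
  "Ah_mult h = ore_mult (poly_der h)"

definition Ah_x :: "'k::field poly poly" where
  "Ah_x = [:[:0, 1:]:]"

definition Ah_t :: "'k::field poly poly" where
  "Ah_t = [:0, 1:]"

definition Der_Ah :: "'k::field poly \<Rightarrow> ('k poly poly \<Rightarrow> 'k poly poly) set" where
  "Der_Ah h = derivations Ah_scale (Ah_mult h)"

text \<open>Existence and uniqueness are shown in \<open>D_poly_unique_existence\<close>.\<close>

definition D_poly :: "'k::field poly \<Rightarrow> 'k poly \<Rightarrow> 'k poly poly \<Rightarrow> 'k poly poly" where
  "D_poly h p = (THE D. D \<in> Der_Ah h \<and> D Ah_x = 0 \<and> D Ah_t = [:p:])"

text \<open>The extension of \<open>h \<partial>\<^sub>x\<close> to \<open>k(x)\<close>, by the quotient rule.\<close>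

definition fract_der :: "'k::field poly \<Rightarrow> 'k poly fract \<Rightarrow> 'k poly fract" where
  "fract_der h q = (THE r. \<exists>a b. b \<noteq> 0 \<and> q = Fract a b \<and>
     r = Fract (h * (pderiv a * b - a * pderiv b)) (b * b))"

text \<open>
  The localization \<open>A\<^sub>h[S\<^sup>-\<^sup>1]\<close>, \<open>S = {\<psi>\<^sup>n}\<close>, is realized inside \<open>k(x)[t; h \<partial>\<^sub>x]\<close> as the set of all
  left fractions \<open>\<psi>\<^sup>-\<^sup>n a\<close> with \<open>a \<in> A\<^sub>h\<close>, where \<open>A\<^sub>h\<close> is embedded by \<open>fract_poly\<close>.  That it is a
  subring containing \<open>\<psi>\<^sup>-\<^sup>1\<close> is shown in \<open>Ah_loc_mult\<close> and the facts next to it.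
\<close>

definition Ah_loc :: "'k::field poly \<Rightarrow> 'k poly fract poly set" where
  "Ah_loc \<psi> = {smult (inverse (to_fract \<psi>) ^ n) (fract_poly a) | n a. True}"

text \<open>
  \<open>E_t h \<psi> f\<close> is the element of \<open>A\<^sub>h\<close> whose image in the localization is \<open>[\<psi>\<^sup>-\<^sup>1 t, f]\<close>; it exists
  and is unique by \<open>E_t_unique_existence\<close>.
\<close>

definition E_t :: "'k::field poly \<Rightarrow> 'k poly \<Rightarrow> 'k poly poly \<Rightarrow> 'k poly poly" where
  "E_t h \<psi> f = (THE e. fract_poly e =
     ore_commutator (fract_der h) [:0, inverse (to_fract \<psi>):] (fract_poly f))"

definition is_gcd :: "'a::comm_semiring_1 \<Rightarrow> 'a \<Rightarrow> 'a \<Rightarrow> bool" where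
  "is_gcd d a b \<longleftrightarrow> d dvd a \<and> d dvd b \<and> (\<forall>e. e dvd a \<longrightarrow> e dvd b \<longrightarrow> e dvd d)"


section \<open>Basic facts: the definitions describe the intended objects\<close>

definition lin_ext :: "(nat \<Rightarrow> 'a::comm_ring_1 poly) \<Rightarrow> 'a poly \<Rightarrow> 'a poly" where
  "lin_ext d f = (\<Sum>i\<le>degree f. smult (coeff f i) (d i))"

lemma lin_ext_bound: "degree f \<le> n \<Longrightarrow> lin_ext d f = (\<Sum>i\<le>n. smult (coeff f i) (d i))"
  unfolding lin_ext_def
  by (rule sum.mono_neutral_left) (auto simp: coeff_eq_0)

lemma lin_ext_add: "lin_ext d (f + g) = lin_ext d f + lin_ext d g"
proof -
  let ?n = "max (degree f) (degree g)"
  have "degree (f + g) \<le> ?n" by (rule degree_add_le) auto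
  then show ?thesis
    by (simp add: lin_ext_bound[of _ ?n] smult_add_left sum.distrib)
qed

lemma lin_ext_smult: "lin_ext d (smult a f) = smult a (lin_ext d f)"
proof -
  have "smult a (\<Sum>i\<le>n. smult (coeff f i) (d i)) =
        (\<Sum>i\<le>n. smult a (smult (coeff f i) (d i)))" for n
    by (induct n) (simp_all add: smult_add_right)
  then show ?thesis
    using degree_smult_le[of a f] by (simp add: lin_ext_bound[of _ "degree f"])
qed

lemma lin_ext_pCons: "lin_ext d (pCons a f) = smult a (d 0) + lin_ext (\<lambda>i. d (Suc i)) f"
proof -
  have "lin_ext d (pCons a f) = (\<Sum>i\<le>Suc (degree f). smult (coeff (pCons a f) i) (d i))"
    by (rule lin_ext_bound) (simp add: degree_pCons_le)
  also have "\<dots> = smult a (d 0) + (\<Sum>i\<le>degree f. smult (coeff f i) (d (Suc i)))"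
    by (subst sum.atMost_Suc_shift) simp
  finally show ?thesis by (simp add: lin_ext_def)
qed

lemma lin_ext_0 [simp]: "lin_ext d 0 = 0"
  by (simp add: lin_ext_def)

lemma ore_mult_lin_ext: "ore_mult \<delta> f g = lin_ext (\<lambda>i. (ore_t_mult \<delta> ^^ i) g) f"
  by (simp add: ore_mult_def lin_ext_def)

lemma ore_mult_0_left [simp]: "ore_mult \<delta> 0 g = 0"
  by (simp add: ore_mult_lin_ext)

lemma ore_mult_add_left: "ore_mult \<delta> (f + f') g = ore_mult \<delta> f g + ore_mult \<delta> f' g"
  by (simp add: ore_mult_lin_ext lin_ext_add)

lemma ore_mult_smult_left: "ore_mult \<delta> (smult a f) g = smult a (ore_mult \<delta> f g)"
  by (simp add: ore_mult_lin_ext lin_ext_smult)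

lemma ore_mult_pCons: "ore_mult \<delta> (pCons a f) g = smult a g + ore_mult \<delta> f (ore_t_mult \<delta> g)"
  by (simp add: ore_mult_lin_ext lin_ext_pCons funpow_Suc_right del: funpow.simps)

lemma ore_mult_diff_left: "ore_mult \<delta> (f - f') g = ore_mult \<delta> f g - ore_mult \<delta> f' g"
  by (metis add_diff_cancel diff_add_cancel ore_mult_add_left)

lemma ore_mult_const_left [simp]: "ore_mult \<delta> [:a:] g = smult a g"
  by (simp add: ore_mult_pCons)

lemma ore_mult_t_left [simp]: "ore_mult \<delta> [:0, 1:] g = ore_t_mult \<delta> g"
  by (simp add: ore_mult_pCons)

context ring_derivation
begin

lemma zero [simp]: "\<delta> 0 = 0"
  using add[of 0 0] by simp

lemma one [simp]: "\<delta> 1 = 0"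
  using mult[of 1 1] by simp

lemma map_add: "map_poly \<delta> (f + g) = map_poly \<delta> f + map_poly \<delta> g"
  by (rule poly_eqI) (simp add: coeff_map_poly add)

lemma map_smult: "map_poly \<delta> (smult a f) = smult (\<delta> a) f + smult a (map_poly \<delta> f)"
  by (rule poly_eqI) (simp add: coeff_map_poly mult)

lemma map_pCons: "map_poly \<delta> (pCons a f) = pCons (\<delta> a) (map_poly \<delta> f)"
  by (rule poly_eqI) (simp add: coeff_map_poly coeff_pCons split: nat.split)

lemma t_add: "ore_t_mult \<delta> (f + g) = ore_t_mult \<delta> f + ore_t_mult \<delta> g"
  using add_pCons[of 0 f 0 g] by (simp add: ore_t_mult_def map_add)

lemma t_0 [simp]: "ore_t_mult \<delta> 0 = 0"
  by (simp add: ore_t_mult_def)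

lemma t_smult: "ore_t_mult \<delta> (smult a f) = smult a (ore_t_mult \<delta> f) + smult (\<delta> a) f"
  by (simp add: ore_t_mult_def map_smult smult_add_right)

lemma t_pCons: "ore_t_mult \<delta> (pCons a f) = [:\<delta> a, a:] + pCons 0 (ore_t_mult \<delta> f)"
  by (simp add: ore_t_mult_def map_pCons)

lemma mult_add_right: "ore_mult \<delta> f (g + g') = ore_mult \<delta> f g + ore_mult \<delta> f g'"
  by (induct f arbitrary: g g') (simp_all add: ore_mult_pCons t_add smult_add_right)

lemma mult_0_right [simp]: "ore_mult \<delta> f 0 = 0"
  by (induct f) (simp_all add: ore_mult_pCons)

lemma mult_diff_right: "ore_mult \<delta> f (g - g') = ore_mult \<delta> f g - ore_mult \<delta> f g'"
  by (metis add_diff_cancel diff_add_cancel mult_add_right)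

lemma mult_1_right [simp]: "ore_mult \<delta> f 1 = f"
proof -
  have *: "ore_mult \<delta> f (pCons 0 g) = pCons 0 (ore_mult \<delta> f g)" for f g
    by (induct f arbitrary: g) (simp_all add: ore_mult_pCons t_pCons)
  show ?thesis
  proof (induct f)
    case (pCons a f)
    have "ore_t_mult \<delta> 1 = pCons 0 1" by (simp add: ore_t_mult_def map_poly_1)
    with pCons * show ?case by (simp add: ore_mult_pCons)
  qed simp
qed

lemma mult_1_left [simp]: "ore_mult \<delta> 1 f = f"
  unfolding one_pCons by simp

lemma mult_pCons_0_right: "ore_mult \<delta> f (pCons 0 g) = pCons 0 (ore_mult \<delta> f g)"
  by (induct f arbitrary: g) (simp_all add: ore_mult_pCons t_pCons)

lemma mult_t_right: "ore_mult \<delta> f [:0, 1:] = pCons 0 f"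
  using mult_pCons_0_right[of f 1] unfolding mult_1_right by (simp add: one_pCons)

lemma t_mult: "ore_mult \<delta> (ore_t_mult \<delta> f) g = ore_t_mult \<delta> (ore_mult \<delta> f g)"
proof (induct f arbitrary: g)
  case (pCons a f)
  then show ?case
    by (simp add: t_pCons ore_mult_add_left ore_mult_pCons t_add t_smult)
qed simp

theorem mult_assoc:
  "ore_mult \<delta> (ore_mult \<delta> f g) k = ore_mult \<delta> f (ore_mult \<delta> g k)"
  by (induct f arbitrary: g)
    (simp_all add: ore_mult_pCons ore_mult_add_left ore_mult_smult_left t_mult)

lemma commutator_mult:
  "ore_commutator \<delta> a (ore_mult \<delta> f g) =
     ore_mult \<delta> (ore_commutator \<delta> a f) g + ore_mult \<delta> f (ore_commutator \<delta> a g)"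
  by (simp add: ore_commutator_def ore_mult_diff_left mult_diff_right mult_assoc)

lemma commutator_add:
  "ore_commutator \<delta> a (f + g) = ore_commutator \<delta> a f + ore_commutator \<delta> a g"
  by (simp add: ore_commutator_def ore_mult_add_left mult_add_right)

end

lemma ring_derivation_poly_der: "ring_derivation (poly_der h)"
  by standard (simp_all add: poly_der_def pderiv_add pderiv_mult algebra_simps)

interpretation Ah: ring_derivation "poly_der h" for h :: "'k::field poly"
  by (rule ring_derivation_poly_der)

lemma Ah_relation: "Ah_mult h Ah_t Ah_x - Ah_mult h Ah_x Ah_t = [:h:]"
  by (simp add: Ah_mult_def Ah_t_def Ah_x_def ore_t_mult_def Ah.map_pCons poly_der_def pderiv_pCons)

lemma vector_space_Ah_scale: "vector_space Ah_scale"
  by standard (simp_all add: Ah_scale_def smult_add_right mult.commute flip: smult_add_left one_pCons)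

lemma Ah_scale_mult_left: "Ah_mult h (Ah_scale c a) b = Ah_scale c (Ah_mult h a b)"
  by (simp add: Ah_mult_def Ah_scale_def ore_mult_smult_left)

lemma Ah_scale_mult_right: "Ah_mult h a (Ah_scale c b) = Ah_scale c (Ah_mult h a b)"
proof -
  have t: "ore_t_mult (poly_der h) (smult [:c:] g) = smult [:c:] (ore_t_mult (poly_der h) g)" for g
    by (simp add: Ah.t_smult poly_der_def pderiv_pCons)
  show ?thesis unfolding Ah_mult_def Ah_scale_def
    by (induct a arbitrary: b) (simp_all add: ore_mult_pCons t smult_add_right mult.commute)
qed

lemma Der_Ah_iff:
  "D \<in> Der_Ah h \<longleftrightarrow> (\<forall>a b. D (a + b) = D a + D b) \<and> (\<forall>c a. D (Ah_scale c a) = Ah_scale c (D a)) \<and>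
     (\<forall>a b. D (Ah_mult h a b) = Ah_mult h (D a) b + Ah_mult h a (D b))"
  using vector_space_Ah_scale
  by (auto simp: Der_Ah_def derivations_def linear_iff_module_hom module_hom_iff
      module_iff_vector_space Vector_Spaces.linear_def)

text \<open>The scalars, \<open>x\<close> and \<open>t\<close> generate \<open>A\<^sub>h\<close>.\<close>

lemma Ah_induct [case_names scalar x t add mult]:
  assumes scalar: "\<And>c. P [:[:c:]:]" and x: "P Ah_x" and t: "P Ah_t"
    and add: "\<And>a b. P a \<Longrightarrow> P b \<Longrightarrow> P (a + b)"
    and mult: "\<And>a b. P a \<Longrightarrow> P b \<Longrightarrow> P (Ah_mult h a b)"
  shows "P f"
proof -
  have c: "P [:p:]" for p
  proof (induct p)
    case 0
    show ?case using scalar[of 0] by simp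
  next
    case (pCons a p)
    have "[:pCons a p:] = [:[:a:]:] + Ah_mult h Ah_x [:p:]"
      by (simp add: Ah_mult_def Ah_x_def)
    with add[OF scalar mult[OF x pCons(2)]] show ?case by metis
  qed
  show ?thesis
  proof (induct f)
    case 0
    show ?case using scalar[of 0] by simp
  next
    case (pCons a f)
    have "pCons a f = [:a:] + Ah_mult h f Ah_t"
      by (simp add: Ah_mult_def Ah_t_def Ah.mult_t_right)
    with add[OF c mult[OF pCons(2) t]] show ?case by metis
  qed
qed

lemma Der_Ah_scalar:
  assumes "D \<in> Der_Ah h"
  shows "D [:[:c:]:] = 0"
proof -
  have "D (Ah_mult h 1 1) = Ah_mult h (D 1) 1 + Ah_mult h 1 (D 1)"
    using assms by (simp add: Der_Ah_iff)
  hence "D 1 = D 1 + D 1" by (simp only: Ah_mult_def Ah.mult_1_left Ah.mult_1_right)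
  hence "D 1 = 0" by (metis add_cancel_right_right)
  moreover have "[:[:c:]:] = Ah_scale c 1" by (simp add: Ah_scale_def one_pCons)
  moreover have "D (Ah_scale c 1) = Ah_scale c (D 1)" using assms by (simp add: Der_Ah_iff)
  ultimately show ?thesis by (simp add: Ah_scale_def)
qed

lemma Der_Ah_eqI:
  assumes D: "D \<in> Der_Ah h" "D' \<in> Der_Ah h" and "D Ah_x = D' Ah_x" "D Ah_t = D' Ah_t"
  shows "D = D'"
proof
  fix f show "D f = D' f"
  proof (induct f rule: Ah_induct[where h = h])
    case (scalar c)
    then show ?case using D by (simp add: Der_Ah_scalar)
  qed (use assms in \<open>simp_all add: Der_Ah_iff\<close>)
qed

lemma D_poly_existence: "\<exists>D. D \<in> Der_Ah h \<and> D Ah_x = 0 \<and> D Ah_t = [:p:]"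
proof -
  let ?m = "ore_mult (poly_der h)"
  let ?T = "ore_t_mult (poly_der h)"
  define d where "d = rec_nat 0 (\<lambda>i r. pCons 0 r + ?m (monom 1 i) [:p:])"
  define D where "D = lin_ext d"
  have d0: "d 0 = 0" and dS: "d (Suc i) = pCons 0 (d i) + ?m (monom 1 i) [:p:]" for i
    by (simp_all add: d_def)
  have D_add: "D (a + b) = D a + D b" for a b by (simp add: D_def lin_ext_add)
  have D_smult: "D (smult a b) = smult a (D b)" for a b by (simp add: D_def lin_ext_smult)
  have D_shift: "D (pCons 0 f) = pCons 0 (D f) + ?m f [:p:]" for f
  proof -
    have e: "lin_ext (\<lambda>i. pCons 0 (u i) + ?m (v i) [:p:]) f =
        pCons 0 (lin_ext u f) + ?m (lin_ext v f) [:p:]" for u v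
      by (induct f arbitrary: u v)
        (simp_all add: lin_ext_pCons smult_add_right ore_mult_add_left ore_mult_smult_left)
    have "lin_ext (monom 1) f = f"
      unfolding lin_ext_def by (simp add: smult_monom poly_as_sum_of_monoms)
    then show ?thesis using e[of d "monom 1"] by (simp add: D_def lin_ext_pCons dS)
  qed
  have D_pCons: "D (pCons a f) = pCons 0 (D f) + ?m f [:p:]" for a f
    using D_add[of "[:a:]" "pCons 0 f"] D_shift[of f]
    by (simp add: D_def lin_ext_pCons d0)
  have D0: "D 0 = 0" by (simp add: D_def)
  have D_T: "D (?T g) = ?T (D g) + smult p g" for g
  proof (induct g)
    case 0
    then show ?case by (simp add: D0)
  next
    case (pCons b g)
    have "D (?T (pCons b g)) = D [:poly_der h b, b:] + D (pCons 0 (?T g))"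
      by (simp only: Ah.t_pCons D_add)
    also have "D [:poly_der h b, b:] = [:b * p:]" by (simp add: D_pCons D0)
    also have "D (pCons 0 (?T g)) = pCons 0 (D (?T g)) + ?m (?T g) [:p:]" by (simp add: D_pCons)
    finally show ?case
      by (simp add: pCons Ah.t_mult D_pCons Ah.t_add Ah.t_pCons mult.commute)
  qed
  have D_mult: "D (?m f g) = ?m (D f) g + ?m f (D g)" for f g
  proof (induct f arbitrary: g)
    case 0
    then show ?case by (simp add: D0)
  next
    case (pCons a f)
    then show ?case
      by (simp add: ore_mult_pCons D_add D_smult D_T D_pCons ore_mult_add_left Ah.mult_assoc
          Ah.mult_add_right)
  qed
  have "D \<in> Der_Ah h"
    by (simp add: Der_Ah_iff D_add D_smult D_mult Ah_scale_def Ah_mult_def)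
  moreover have "D Ah_x = 0" by (simp add: Ah_x_def D_pCons D0)
  moreover have "D Ah_t = [:p:]" by (simp add: Ah_t_def D_pCons D0)
  ultimately show ?thesis by blast
qed

theorem D_poly_unique_existence: "\<exists>!D. D \<in> Der_Ah h \<and> D Ah_x = 0 \<and> D Ah_t = [:p:]"
  using D_poly_existence[of h p] Der_Ah_eqI by (metis (no_types, lifting))

lemma D_poly: "D_poly h p \<in> Der_Ah h" "D_poly h p Ah_x = 0" "D_poly h p Ah_t = [:p:]"
  using theI'[OF D_poly_unique_existence[of h p]] by (simp_all add: D_poly_def)

lemma fract_der_Fract:
  assumes b: "b \<noteq> 0"
  shows "fract_der h (Fract a b) = Fract (h * (pderiv a * b - a * pderiv b)) (b * b)"
proof -
  have "Fract (h * (pderiv c * d - c * pderiv d)) (d * d) =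
        Fract (h * (pderiv a * b - a * pderiv b)) (b * b)"
    if d: "d \<noteq> 0" and eq: "Fract a b = Fract c d" for c d
  proof -
    from eq have e: "a * d = c * b" using b d by (simp add: eq_fract)
    hence "pderiv (a * d) = pderiv (c * b)" by simp
    hence e': "pderiv a * d + a * pderiv d = pderiv c * b + c * pderiv b"
      by (simp add: pderiv_mult algebra_simps)
    have "(pderiv a * b - a * pderiv b) * (d * d) = (pderiv c * d - c * pderiv d) * (b * b)"
      using e e' by algebra
    then show ?thesis using b d by (simp add: eq_fract mult.assoc)
  qed
  with b show ?thesis
    unfolding fract_der_def by (intro the_equality) blast+
qed

lemma fract_der_to_fract: "fract_der h (to_fract p) = to_fract (poly_der h p)"
  by (simp add: to_fract_def fract_der_Fract poly_der_def)

lemma ring_derivation_fract_der: "ring_derivation (fract_der h)"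
proof
  fix q r :: "'a poly fract"
  obtain a b where q: "q = Fract a b" "b \<noteq> 0" by (cases q)
  obtain c d where r: "r = Fract c d" "d \<noteq> 0" by (cases r)
  show "fract_der h (q + r) = fract_der h q + fract_der h r"
    using q r by (simp add: fract_der_Fract eq_fract pderiv_add pderiv_mult algebra_simps)
  show "fract_der h (q * r) = fract_der h q * r + q * fract_der h r"
    using q r by (simp add: fract_der_Fract eq_fract pderiv_add pderiv_mult algebra_simps)
qed

interpretation Kx: ring_derivation "fract_der h" for h :: "'k::field poly"
  by (rule ring_derivation_fract_der)

lemma fract_poly_inj: "fract_poly a = fract_poly b \<longleftrightarrow> a = b"
  by (auto simp: poly_eq_iff coeff_map_poly)

lemma fract_poly_pCons: "fract_poly (pCons a f) = pCons (to_fract a) (fract_poly f)"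
  by (rule poly_eqI) (simp add: coeff_map_poly coeff_pCons split: nat.split)

lemma fract_poly_t_mult:
  "fract_poly (ore_t_mult (poly_der h) f) = ore_t_mult (fract_der h) (fract_poly f)"
  by (rule poly_eqI)
    (simp add: ore_t_mult_def coeff_map_poly coeff_pCons fract_der_to_fract split: nat.split)

theorem fract_poly_Ah_mult:
  "fract_poly (Ah_mult h f g) = ore_mult (fract_der h) (fract_poly f) (fract_poly g)"
  unfolding Ah_mult_def
  by (induct f arbitrary: g)
    (simp_all add: ore_mult_pCons fract_poly_pCons fract_poly_t_mult)

theorem E_t_unique_existence:
  assumes "\<psi> dvd h" "\<psi> dvd pderiv h" "\<psi> \<noteq> 0"
  shows "\<exists>!e. fract_poly e =
    ore_commutator (fract_der h) [:0, inverse (to_fract \<psi>):] (fract_poly f)"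
proof -
  let ?u = "[:0, inverse (to_fract \<psi>):]"
  obtain g where g: "h = \<psi> * g" using assms(1) by blast
  hence "pderiv h = \<psi> * pderiv g + g * pderiv \<psi>" by (simp add: pderiv_mult)
  with assms(2) have "\<psi> dvd g * pderiv \<psi>" by (metis dvd_add_right_iff dvd_triv_left)
  then obtain k where k: "g * pderiv \<psi> = \<psi> * k" by blast
  have nz: "to_fract \<psi> \<noteq> 0" using assms(3) by simp
  have "fract_der h (inverse (to_fract \<psi>)) = Fract (- (h * pderiv \<psi>)) (\<psi> * \<psi>)"
    using assms(3) by (simp add: to_fract_def fract_der_Fract)
  also have "h * pderiv \<psi> = k * (\<psi> * \<psi>)"
    using k by (simp add: g mult.assoc mult.commute)
  finally have inv: "fract_der h (inverse (to_fract \<psi>)) = - to_fract k"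
    using assms(3) by (simp add: to_fract_def eq_fract)
  have "\<exists>e. fract_poly e = ore_commutator (fract_der h) ?u (fract_poly f)"
  proof (induct f rule: Ah_induct[where h = h])
    case (scalar c)
    have "fract_der h (to_fract [:c:]) = 0"
      by (simp add: fract_der_to_fract poly_der_def pderiv_pCons)
    hence "ore_commutator (fract_der h) ?u (fract_poly [:[:c:]:]) = fract_poly 0"
      by (simp add: ore_commutator_def ore_mult_pCons fract_poly_pCons Kx.t_pCons mult.commute)
    then show ?case by metis
  next
    case x
    have "inverse (to_fract \<psi>) * to_fract h = to_fract g"
      using nz by (simp add: g)
    moreover have "fract_der h (to_fract [:0, 1:]) = to_fract h"
      by (simp add: fract_der_to_fract poly_der_def pderiv_pCons)
    ultimately have "ore_commutator (fract_der h) ?u (fract_poly Ah_x) = fract_poly [:g:]"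
      by (simp add: Ah_x_def ore_commutator_def ore_mult_pCons fract_poly_pCons Kx.t_pCons
          mult.commute)
    then show ?case by metis
  next
    case t
    have "ore_commutator (fract_der h) ?u (fract_poly Ah_t) = fract_poly [:0, k:]"
      using nz by (simp add: Ah_t_def ore_commutator_def ore_mult_pCons fract_poly_pCons
          Kx.t_pCons inv)
    then show ?case by metis
  next
    case (add a b)
    then obtain e e' where "fract_poly e = ore_commutator (fract_der h) ?u (fract_poly a)"
      "fract_poly e' = ore_commutator (fract_der h) ?u (fract_poly b)" by blast
    hence "fract_poly (e + e') = ore_commutator (fract_der h) ?u (fract_poly (a + b))"
      by (simp add: Kx.commutator_add)
    then show ?case by blast
  next
    case (mult a b)
    then obtain e e' where "fract_poly e = ore_commutator (fract_der h) ?u (fract_poly a)"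
      "fract_poly e' = ore_commutator (fract_der h) ?u (fract_poly b)" by blast
    hence "fract_poly (Ah_mult h e b + Ah_mult h a e') =
        ore_commutator (fract_der h) ?u (fract_poly (Ah_mult h a b))"
      by (simp add: Kx.commutator_mult fract_poly_Ah_mult)
    then show ?case by blast
  qed
  then show ?thesis by (metis fract_poly_inj)
qed

text \<open>\<open>Ah_loc \<psi>\<close> is a subring containing \<open>A\<^sub>h\<close> and \<open>\<psi>\<^sup>-\<^sup>1 t\<close> in which \<open>\<psi>\<close> is invertible.\<close>

lemma Ah_loc_fract_poly: "fract_poly a \<in> Ah_loc \<psi>"
  unfolding Ah_loc_def by (auto intro!: exI[of _ 0] exI[of _ a])

lemma Ah_loc_smult:
  assumes "u \<in> Ah_loc \<psi>"
  shows "smult (inverse (to_fract \<psi>)) u \<in> Ah_loc \<psi>" "smult (to_fract p) u \<in> Ah_loc \<psi>"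
proof -
  from assms obtain n a where u: "u = smult (inverse (to_fract \<psi>) ^ n) (fract_poly a)"
    unfolding Ah_loc_def by blast
  have "smult (inverse (to_fract \<psi>)) u = smult (inverse (to_fract \<psi>) ^ Suc n) (fract_poly a)"
    by (simp add: u)
  then show "smult (inverse (to_fract \<psi>)) u \<in> Ah_loc \<psi>" unfolding Ah_loc_def by blast
  have "smult (to_fract p) u = smult (inverse (to_fract \<psi>) ^ n) (fract_poly (smult p a))"
    by (simp add: u mult.commute)
  then show "smult (to_fract p) u \<in> Ah_loc \<psi>" unfolding Ah_loc_def by blast
qed

lemma Ah_loc_inverse: "[:inverse (to_fract \<psi>):] \<in> Ah_loc \<psi>"
  using Ah_loc_smult(1)[OF Ah_loc_fract_poly[of 1 \<psi>]] by (simp add: map_poly_1)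

lemma Ah_loc_inverse_t: "[:0, inverse (to_fract \<psi>):] \<in> Ah_loc \<psi>"
  using Ah_loc_smult(1)[OF Ah_loc_fract_poly[of Ah_t \<psi>]]
  by (simp add: Ah_t_def fract_poly_pCons)

lemma Ah_loc_add:
  assumes nz: "\<psi> \<noteq> 0" and u: "u \<in> Ah_loc \<psi>" and v: "v \<in> Ah_loc \<psi>"
  shows "u + v \<in> Ah_loc \<psi>"
proof -
  let ?i = "inverse (to_fract \<psi>)"
  obtain n a m b where uv: "u = smult (?i ^ n) (fract_poly a)" "v = smult (?i ^ m) (fract_poly b)"
    using u v unfolding Ah_loc_def by blast
  have p: "to_fract (\<psi> ^ k) = to_fract \<psi> ^ k" for k by (induct k) simp_all
  have c: "?i ^ (k + l) * to_fract \<psi> ^ l = ?i ^ k" for k l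
    using nz by (simp add: power_add field_simps)
  have "u + v = smult (?i ^ (n + m)) (fract_poly (smult (\<psi> ^ m) a + smult (\<psi> ^ n) b))"
    using c[of n m] c[of m n] by (simp add: uv smult_add_right p add.commute)
  then show ?thesis unfolding Ah_loc_def by blast
qed

theorem Ah_loc_mult:
  assumes nz: "\<psi> \<noteq> 0" and u: "u \<in> Ah_loc \<psi>" and v: "v \<in> Ah_loc \<psi>"
  shows "ore_mult (fract_der h) u v \<in> Ah_loc \<psi>"
proof -
  let ?i = "inverse (to_fract \<psi>)"
  have pow: "smult (?i ^ n) w \<in> Ah_loc \<psi>" if "w \<in> Ah_loc \<psi>" for n w
  proof (induct n)
    case (Suc n)
    then show ?case using Ah_loc_smult(1) by fastforce
  qed (use that in simp)
  have t: "ore_t_mult (fract_der h) w \<in> Ah_loc \<psi>" if w: "w \<in> Ah_loc \<psi>" for w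
  proof -
    obtain n a where wa: "w = smult (?i ^ n) (fract_poly a)" using w unfolding Ah_loc_def by blast
    have "?i ^ n = Fract 1 (\<psi> ^ n)" for n
      by (induct n) (simp_all add: to_fract_def One_fract_def)
    hence d: "fract_der h (?i ^ n) = to_fract (- (h * pderiv (\<psi> ^ n))) * ?i ^ (n + n)"
      using nz by (simp add: fract_der_Fract to_fract_def power_add)
    have "ore_t_mult (fract_der h) w = smult (?i ^ n) (fract_poly (ore_t_mult (poly_der h) a)) +
        smult (to_fract (- (h * pderiv (\<psi> ^ n)))) (smult (?i ^ (n + n)) (fract_poly a))"
      by (simp only: wa Kx.t_smult d fract_poly_t_mult smult_smult)
    then show ?thesis
      by (simp only:) (intro Ah_loc_add[OF nz] pow Ah_loc_smult(2) Ah_loc_fract_poly)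
  qed
  have "ore_mult (fract_der h) (fract_poly a) w \<in> Ah_loc \<psi>" if "w \<in> Ah_loc \<psi>" for a w
    using that
  proof (induct a arbitrary: w)
    case 0
    then show ?case using Ah_loc_fract_poly[of 0 \<psi>] by simp
  next
    case (pCons c a)
    then show ?case
      using Ah_loc_add[OF nz Ah_loc_smult(2) pCons(2)[OF t]]
      by (simp add: fract_poly_pCons ore_mult_pCons)
  qed
  with u v show ?thesis
    using pow unfolding Ah_loc_def[of \<psi>] by (force simp: ore_mult_smult_left)
qed

end

theory Submission
  imports Defs
begin

text \<open>
  Write \<open>D x = a t\<^sup>d + \<dots>\<close> and \<open>D t = b t\<^sup>d\<^sup>+\<^sup>1 + \<dots>\<close>, with lower powers of \<open>t\<close> omitted and \<open>d \<ge> 0\<close>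
  as small as possible.  Up to lower powers of \<open>t\<close> the derivation acts by
  \<open>f t\<^sup>j \<mapsto> (a f' + j b f) t\<^sup>j\<^sup>+\<^sup>d\<close> (\<open>Der_Ah_top\<close>), and comparing the coefficients of \<open>t\<^sup>d\<close> after applying
  \<open>D\<close> to \<open>t x - x t = h\<close> gives \<open>(d + 1) b h + h a' = a h'\<close> (\<open>Der_Ah_top_relation\<close>).

  For nonconstant \<open>a\<close> this relation fixes the coefficient of \<open>b\<close> in degree \<open>deg a - 1\<close>.  Following
  the leading monomial of \<open>D\<^sup>n x\<close>, first in \<open>t\<close> and then in \<open>x\<close>, one finds a nonzero multiple of
  \<open>x ^ (1 + n (deg a - 1)) t ^ (n d)\<close>: up to factors that are visibly nonzero, the scalar is a product
  of positive integers (\<open>Der_Ah_growth\<close>).  Local finiteness says that the monomials occurring along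
  each orbit are bounded (\<open>locally_finite_iff_bounded_orbits\<close>), so it forces \<open>d = 0\<close> and \<open>deg a \<le> 1\<close>.

  The same relation shows \<open>h dvd a h'\<close>.  Since \<open>h / \<psi>\<close> and \<open>h' / \<psi>\<close> are coprime, \<open>g dvd a\<close>.
  If \<open>deg g \<ge> 2\<close> then \<open>a = 0\<close>; if \<open>deg g = 1\<close> then \<open>D x\<close> is a scalar multiple of \<open>g = E\<^sub>t x\<close>, and
  subtracting this multiple of \<open>E\<^sub>t\<close> leaves a derivation killing \<open>x\<close>.  A derivation that kills \<open>x\<close>
  maps \<open>t\<close> into the centralizer \<open>k[x]\<close> of \<open>x\<close>, so it is some \<open>D\<^sub>p\<close> (\<open>Der_Ah_eq_D_poly\<close>).

  Conversely \<open>D\<^sub>p\<close> lowers the degree in \<open>t\<close> and is locally nilpotent.  For \<open>deg g = 1\<close> the derivation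
  \<open>\<lambda> E\<^sub>t + D\<^sub>p\<close> sends \<open>x\<close> to a polynomial of degree at most \<open>1\<close> and \<open>t\<close> to a scalar multiple of \<open>t\<close> plus
  a polynomial in \<open>x\<close>.  If \<open>x\<close> gets weight \<open>1\<close> and \<open>t\<close> a sufficiently large weight, then weights add
  under multiplication and the derivation does not raise them, and there are only finitely many
  monomials of bounded weight (\<open>affine_Der_Ah_locally_finite\<close>).
\<close>


section \<open>Bounded orbits\<close>

definition coeff_box :: "nat \<Rightarrow> 'k::field poly poly set" where
  "coeff_box K = {f. \<forall>j i. coeff (coeff f j) i \<noteq> 0 \<longrightarrow> j \<le> K \<and> i \<le> K}"

interpretation Ah_vs: vector_space "Ah_scale :: 'k::field \<Rightarrow> 'k poly poly \<Rightarrow> 'k poly poly"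
  by (rule vector_space_Ah_scale)

lemma coeff_box_mono: "K \<le> L \<Longrightarrow> coeff_box K \<subseteq> coeff_box L"
  by (fastforce simp: coeff_box_def)

lemma subspace_coeff_box: "Ah_vs.subspace (coeff_box K)"
  unfolding Ah_vs.subspace_def coeff_box_def Ah_scale_def by simp (metis add_0)

lemma coeff_boxI:
  fixes f :: "'k::field poly poly"
  assumes "degree f \<le> K" and "\<And>j. degree (coeff f j) \<le> K"
  shows "f \<in> coeff_box K"
  using assms by (auto simp: coeff_box_def) (metis coeff_0 le_degree le_trans, metis le_degree le_trans)

lemma finite_subset_coeff_box:
  fixes B :: "'k::field poly poly set"
  assumes "finite B"
  shows "\<exists>K. B \<subseteq> coeff_box K"
  using assms
proof induct
  case (insert f B)
  then obtain K where K: "B \<subseteq> coeff_box K" by blast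
  have "f \<in> coeff_box (degree f + (\<Sum>j\<le>degree f. degree (coeff f j)))"
  proof (rule coeff_boxI)
    fix j
    show "degree (coeff f j) \<le> degree f + (\<Sum>j\<le>degree f. degree (coeff f j))"
    proof (cases "j \<le> degree f")
      case True
      then show ?thesis
        by (intro trans_le_add2 member_le_sum) auto
    qed (simp add: coeff_eq_0)
  qed simp
  then obtain L where "f \<in> coeff_box L" by blast
  with K have "insert f B \<subseteq> coeff_box (max K L)"
    using coeff_box_mono[of K "max K L"] coeff_box_mono[of L "max K L"] by auto
  then show ?case by blast
qed simp

lemma coeff_box_subset_span:
  "\<exists>F. finite F \<and> coeff_box K \<subseteq> Ah_vs.span (F :: 'k::field poly poly set)"
proof -
  let ?m = "\<lambda>(i, j). monom (monom (1::'k) i) j"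
  let ?F = "?m ` ({..K} \<times> {..K})"
  have "f \<in> Ah_vs.span ?F" if f: "f \<in> coeff_box K" for f :: "'k poly poly"
  proof -
    have "f = (\<Sum>j\<le>K. \<Sum>i\<le>K. Ah_scale (coeff (coeff f j) i) (?m (i, j)))"
    proof (intro poly_eqI)
      fix j i
      have "coeff (coeff (\<Sum>j\<le>K. \<Sum>i\<le>K. Ah_scale (coeff (coeff f j) i) (?m (i, j))) j) i =
          (\<Sum>j'\<le>K. \<Sum>i'\<le>K. if j' = j \<and> i' = i then coeff (coeff f j') i' else 0)"
        unfolding coeff_sum by (intro sum.cong) (auto simp: Ah_scale_def smult_monom)
      also have "\<dots> = (\<Sum>j'\<le>K. if j' = j then \<Sum>i'\<le>K. if i' = i then coeff (coeff f j') i' else 0 else 0)"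
        by (intro sum.cong) auto
      also have "\<dots> = coeff (coeff f j) i"
        using f by (auto simp: coeff_box_def)
      finally show "coeff (coeff f j) i =
          coeff (coeff (\<Sum>j\<le>K. \<Sum>i\<le>K. Ah_scale (coeff (coeff f j) i) (?m (i, j))) j) i" ..
    qed
    moreover have "\<dots> \<in> Ah_vs.span ?F"
      by (intro Ah_vs.span_sum Ah_vs.span_scale Ah_vs.span_base imageI) auto
    ultimately show ?thesis by metis
  qed
  then show ?thesis by (intro exI[of _ ?F]) auto
qed

text \<open>
  A finite set spans only elements whose monomials come from a finite list; conversely a subset of
  a finitely generated space has a finite basis chosen among its own elements.  In this form local
  finiteness can be refuted by exhibiting coefficients and proved by an invariant filtration.
\<close>

theorem locally_finite_iff_bounded_orbits:
  fixes D :: "'k::field poly poly \<Rightarrow> 'k poly poly"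
  shows "locally_finite Ah_scale D \<longleftrightarrow> (\<forall>f. \<exists>K. \<forall>n. (D ^^ n) f \<in> coeff_box K)"
proof -
  have "(\<exists>B. finite B \<and> Ah_vs.span B = Ah_vs.span S) \<longleftrightarrow> (\<exists>K. S \<subseteq> coeff_box K)"
    for S :: "'k poly poly set"
  proof
    assume "\<exists>B. finite B \<and> Ah_vs.span B = Ah_vs.span S"
    then obtain B where B: "finite B" "Ah_vs.span B = Ah_vs.span S" by blast
    obtain K where "B \<subseteq> coeff_box K" using finite_subset_coeff_box[OF B(1)] by blast
    hence "Ah_vs.span B \<subseteq> coeff_box K" by (rule Ah_vs.span_minimal[OF _ subspace_coeff_box])
    then show "\<exists>K. S \<subseteq> coeff_box K" using B(2) Ah_vs.span_superset[of S] by auto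
  next
    assume "\<exists>K. S \<subseteq> coeff_box K"
    then obtain F where F: "finite F" "S \<subseteq> Ah_vs.span F"
      by (meson coeff_box_subset_span order_trans)
    obtain B where B: "B \<subseteq> S" "Ah_vs.independent B" "S \<subseteq> Ah_vs.span B"
      using Ah_vs.maximal_independent_subset[of S] by blast
    have "finite B" using Ah_vs.independent_span_bound[OF F(1) B(2)] B(1) F(2) by auto
    moreover have "Ah_vs.span B = Ah_vs.span S"
      using B Ah_vs.span_mono[OF B(1)] Ah_vs.span_minimal[OF B(3)] by auto
    ultimately show "\<exists>B. finite B \<and> Ah_vs.span B = Ah_vs.span S" by blast
  qed
  moreover have "{(D ^^ n) f |n. True} \<subseteq> S \<longleftrightarrow> (\<forall>n. (D ^^ n) f \<in> S)" for f S by auto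
  ultimately show ?thesis unfolding locally_finite_def by simp
qed

lemma locally_nilpotent_imp_locally_finite:
  fixes D :: "'k::field poly poly \<Rightarrow> 'k poly poly"
  assumes "D 0 = 0" and "locally_nilpotent D"
  shows "locally_finite Ah_scale D"
  unfolding locally_finite_iff_bounded_orbits
proof
  fix f
  obtain N where N: "(D ^^ N) f = 0" using assms(2) by (auto simp: locally_nilpotent_def)
  have "(D ^^ n) f = 0" if "n \<ge> N" for n
    using that by (induct n rule: dec_induct) (simp_all add: N assms(1))
  hence "(D ^^ n) f \<in> insert 0 ((\<lambda>n. (D ^^ n) f) ` {..<N})" for n
    by (cases "n < N") auto
  moreover obtain K where "insert 0 ((\<lambda>n. (D ^^ n) f) ` {..<N}) \<subseteq> coeff_box K"
    using finite_subset_coeff_box[of "insert 0 ((\<lambda>n. (D ^^ n) f) ` {..<N})"] by auto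
  ultimately show "\<exists>K. \<forall>n. (D ^^ n) f \<in> coeff_box K" by blast
qed


section \<open>Symbols of derivations\<close>

context ring_derivation
begin

lemma t_top:
  assumes "degree g \<le> j"
  shows "degree (ore_t_mult \<delta> g) \<le> Suc j" "coeff (ore_t_mult \<delta> g) (Suc j) = coeff g j"
proof -
  have "degree (map_poly \<delta> g) \<le> j"
    using assms by (intro degree_le) (simp add: coeff_map_poly coeff_eq_0)
  with assms show "degree (ore_t_mult \<delta> g) \<le> Suc j"
      "coeff (ore_t_mult \<delta> g) (Suc j) = coeff g j"
    by (auto simp: ore_t_mult_def coeff_eq_0 intro!: degree_add_le degree_pCons_le[THEN le_trans])
qed

lemma mult_top:
  assumes "degree f \<le> i" "degree g \<le> j"
  shows "degree (ore_mult \<delta> f g) \<le> i + j" "coeff (ore_mult \<delta> f g) (i + j) = coeff f i * coeff g j"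
proof -
  have "degree (ore_mult \<delta> f g) \<le> i + j \<and> coeff (ore_mult \<delta> f g) (i + j) = coeff f i * coeff g j"
    using assms
  proof (induct f arbitrary: g i j)
    case (pCons c f)
    show ?case
    proof (cases i)
      case 0
      with pCons have "f = 0" by (auto split: if_splits)
      with 0 pCons(4) show ?thesis
        by (simp add: ore_mult_pCons degree_smult_le[THEN le_trans])
    next
      case (Suc i')
      with pCons(3) have "degree f \<le> i'" by (cases "f = 0") auto
      from pCons(2)[OF this t_top(1)[OF pCons(4)]] Suc t_top(2)[OF pCons(4)] pCons(4) show ?thesis
        by (auto simp: ore_mult_pCons coeff_eq_0
            intro!: degree_add_le degree_smult_le[THEN le_trans])
    qed
  qed simp
  then show "degree (ore_mult \<delta> f g) \<le> i + j"
    "coeff (ore_mult \<delta> f g) (i + j) = coeff f i * coeff g j" by blast+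
qed

text \<open>
  Commuting \<open>r\<close> past one of the \<open>n + 1\<close> factors of \<open>t\<^sup>n\<^sup>+\<^sup>1\<close> costs one power of \<open>t\<close> and produces one
  \<open>\<delta> r\<close>; differentiating \<open>r\<close> more than once only contributes to lower powers.
\<close>

lemma commutator_const_top:
  assumes "degree f \<le> Suc n"
  shows "degree (ore_commutator \<delta> f [:r:]) \<le> n"
    "coeff (ore_commutator \<delta> f [:r:]) n = of_nat (Suc n) * coeff f (Suc n) * \<delta> r"
proof -
  have step: "ore_commutator \<delta> (pCons c f) [:r:] =
      pCons 0 (ore_commutator \<delta> f [:r:]) + ore_mult \<delta> f [:\<delta> r:]" for c f
  proof -
    have "ore_t_mult \<delta> [:r:] = pCons 0 [:r:] + [:\<delta> r:]"
      by (simp add: ore_t_mult_def map_pCons)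
    hence "ore_mult \<delta> f (ore_t_mult \<delta> [:r:]) =
        pCons 0 (ore_mult \<delta> f [:r:]) + ore_mult \<delta> f [:\<delta> r:]"
      by (simp only: mult_add_right mult_pCons_0_right)
    then show ?thesis
      by (simp add: ore_commutator_def ore_mult_pCons mult.commute)
  qed
  have "degree (ore_commutator \<delta> f [:r:]) \<le> n \<and>
      coeff (ore_commutator \<delta> f [:r:]) n = of_nat (Suc n) * coeff f (Suc n) * \<delta> r"
    using assms
  proof (induct f arbitrary: n)
    case 0
    then show ?case by (simp add: ore_commutator_def)
  next
    case (pCons c f)
    then have f: "degree f \<le> n" by (cases "f = 0") auto
    note m = mult_top[OF f, of "[:\<delta> r:]" 0]
    show ?case
    proof (cases n)
      case 0
      with f obtain e where "f = [:e:]" by (metis degree_0_id le_zero_eq)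
      moreover have "ore_commutator \<delta> [:e:] [:r:] = 0"
        by (simp add: ore_commutator_def mult.commute)
      ultimately show ?thesis using 0 by (simp add: step)
    next
      case (Suc n')
      with pCons(2)[of n'] f m show ?thesis
        by (auto simp: step algebra_simps intro!: degree_add_le degree_pCons_le[THEN le_trans])
    qed
  qed
  then show "degree (ore_commutator \<delta> f [:r:]) \<le> n"
    "coeff (ore_commutator \<delta> f [:r:]) n = of_nat (Suc n) * coeff f (Suc n) * \<delta> r" by blast+
qed

end

lemma Der_Ah_zero: "D \<in> Der_Ah h \<Longrightarrow> D 0 = 0"
  using Der_Ah_scalar[of D h 0] by simp

lemma Der_Ah_pCons:
  assumes "D \<in> Der_Ah h"
  shows "D (pCons c f) = D [:c:] + pCons 0 (D f) + Ah_mult h f (D Ah_t)"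
proof -
  have "pCons c f = [:c:] + Ah_mult h f Ah_t"
    by (simp add: Ah_mult_def Ah_t_def Ah.mult_t_right)
  hence "D (pCons c f) = D [:c:] + (Ah_mult h (D f) Ah_t + Ah_mult h f (D Ah_t))"
    using assms by (simp only: Der_Ah_iff)
  then show ?thesis by (simp add: Ah_mult_def Ah_t_def Ah.mult_t_right add.assoc)
qed

lemma Der_Ah_const_top:
  assumes D: "D \<in> Der_Ah h" and x: "degree (D Ah_x) \<le> d"
  shows "degree (D [:c:]) \<le> d \<and> coeff (D [:c:]) d = coeff (D Ah_x) d * pderiv c"
proof (induct c)
  case 0
  then show ?case using D by (simp add: Der_Ah_zero)
next
  case (pCons e c)
  have "[:pCons e c:] = [:[:e:]:] + Ah_mult h Ah_x [:c:]"
    by (simp add: Ah_mult_def Ah_x_def)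
  hence "D [:pCons e c:] = Ah_mult h (D Ah_x) [:c:] + Ah_mult h Ah_x (D [:c:])"
    using D Der_Ah_scalar[OF D, of e] by (simp only: Der_Ah_iff) simp
  then show ?case
    using pCons Ah.mult_top[OF x, of "[:c:]" 0 h] Ah.mult_top[of Ah_x 0 "D [:c:]" d h]
    by (auto simp: Ah_mult_def Ah_x_def pderiv_pCons algebra_simps intro!: degree_add_le)
qed

text \<open>
  The symbol of \<open>D\<close>: the derivation that it induces on the associated graded ring for the
  filtration by degree in \<open>t\<close>, computed on \<open>f t\<^sup>j\<close>.
\<close>

theorem Der_Ah_top:
  assumes D: "D \<in> Der_Ah h" and x: "degree (D Ah_x) \<le> d" and t: "degree (D Ah_t) \<le> Suc d"
    and f: "degree f \<le> j"
  shows "degree (D f) \<le> j + d"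
    "coeff (D f) (j + d) =
       coeff (D Ah_x) d * pderiv (coeff f j) + of_nat j * coeff (D Ah_t) (Suc d) * coeff f j"
proof -
  have "degree (D f) \<le> j + d \<and> coeff (D f) (j + d) =
      coeff (D Ah_x) d * pderiv (coeff f j) + of_nat j * coeff (D Ah_t) (Suc d) * coeff f j"
    using f
  proof (induct f arbitrary: j)
    case 0
    then show ?case using D by (simp add: Der_Ah_zero)
  next
    case (pCons c f)
    note c = Der_Ah_const_top[OF D x, of c]
    show ?case
    proof (cases j)
      case 0
      with pCons(3) have "f = 0" by (auto split: if_splits)
      with 0 c show ?thesis by simp
    next
      case (Suc j')
      with pCons(3) have f: "degree f \<le> j'" by (cases "f = 0") auto
      let ?u = "Ah_mult h f (D Ah_t)"
      have u: "degree ?u \<le> Suc (j' + d)" "coeff ?u (Suc (j' + d)) = coeff f j' * coeff (D Ah_t) (Suc d)"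
        using Ah.mult_top[OF f t, of h] by (simp_all add: Ah_mult_def)
      have "degree (pCons 0 (D f)) \<le> Suc (j' + d)"
        using pCons(2)[OF f] by (auto intro: degree_pCons_le[THEN le_trans])
      hence "degree (D [:c:] + pCons 0 (D f) + ?u) \<le> Suc (j' + d)"
        using c u(1) by (intro degree_add_le) auto
      moreover have "coeff (D [:c:]) (Suc (j' + d)) = 0"
        using c by (intro coeff_eq_0) auto
      ultimately show ?thesis
        unfolding Der_Ah_pCons[OF D, of c f] Suc
        using pCons(2)[OF f] u(2) by (simp add: algebra_simps)
    qed
  qed
  then show "degree (D f) \<le> j + d"
    "coeff (D f) (j + d) =
       coeff (D Ah_x) d * pderiv (coeff f j) + of_nat j * coeff (D Ah_t) (Suc d) * coeff f j"
    by blast+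
qed

text \<open>
  \<open>D\<close> applied to the defining relation \<open>t x = x t + h\<close>.  The coefficientwise derivation of \<open>D x\<close>
  is the commutator \<open>[t, D x]\<close>.
\<close>

lemma Der_Ah_relation:
  assumes D: "D \<in> Der_Ah h"
  shows "ore_commutator (poly_der h) (D Ah_t) Ah_x + map_poly (poly_der h) (D Ah_x) = D [:h:]"
proof -
  have "Ah_mult h Ah_t Ah_x = [:h:] + Ah_mult h Ah_x Ah_t"
    using Ah_relation[of h] by (simp add: diff_eq_eq)
  hence "Ah_mult h (D Ah_t) Ah_x + Ah_mult h Ah_t (D Ah_x) =
      D [:h:] + (Ah_mult h (D Ah_x) Ah_t + Ah_mult h Ah_x (D Ah_t))"
    using D by (metis Der_Ah_iff)
  moreover have "Ah_mult h Ah_t (D Ah_x) = pCons 0 (D Ah_x) + map_poly (poly_der h) (D Ah_x)"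
    by (simp add: Ah_mult_def Ah_t_def ore_t_mult_def)
  moreover have "Ah_mult h (D Ah_x) Ah_t = pCons 0 (D Ah_x)"
    by (simp add: Ah_mult_def Ah_t_def Ah.mult_t_right)
  ultimately show ?thesis by (simp add: ore_commutator_def Ah_mult_def algebra_simps)
qed

text \<open>
  The symbol of \<open>D\<close> respects the Poisson bracket \<open>{t, x} = h\<close> induced by the commutator.
\<close>

theorem Der_Ah_top_relation:
  assumes D: "D \<in> Der_Ah h" and x: "degree (D Ah_x) \<le> d" and t: "degree (D Ah_t) \<le> Suc d"
  shows "of_nat (Suc d) * coeff (D Ah_t) (Suc d) * h + h * pderiv (coeff (D Ah_x) d) =
    coeff (D Ah_x) d * pderiv h"
proof -
  have "coeff (ore_commutator (poly_der h) (D Ah_t) Ah_x + map_poly (poly_der h) (D Ah_x)) d =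
      coeff (D [:h:]) d"
    by (simp only: Der_Ah_relation[OF D])
  then show ?thesis
    using Der_Ah_const_top[OF D x, of h] Ah.commutator_const_top(2)[OF t, of h "[:0, 1:]"]
    by (simp add: coeff_map_poly Ah_x_def poly_der_def pderiv_pCons)
qed

text \<open>
  \<open>D t\<close> commutes with \<open>x\<close>, because \<open>D\<close> kills \<open>x\<close> and \<open>h\<close>.  A leading term \<open>b t\<^sup>n\<^sup>+\<^sup>1\<close> would contribute
  \<open>(n + 1) b h t\<^sup>n\<close> to the commutator, which is impossible in characteristic zero.
\<close>

lemma Der_Ah_eq_D_poly:
  fixes h :: "'k::field_char_0 poly"
  assumes D: "D \<in> Der_Ah h" and h: "h \<noteq> 0" and x: "D Ah_x = 0"
  shows "\<exists>p. D = D_poly h p"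
proof -
  have "degree (D Ah_t) = 0"
  proof (cases "degree (D Ah_t)")
    case (Suc n)
    with Der_Ah_top_relation[OF D, of n] x h have "coeff (D Ah_t) (Suc n) = 0"
      by (simp del: of_nat_Suc)
    with Suc show ?thesis by (metis leading_coeff_0_iff degree_0)
  qed
  then obtain p where "D Ah_t = [:p:]" by (metis degree_0_id)
  with Der_Ah_eqI[OF D D_poly(1)] x have "D = D_poly h p" by (simp add: D_poly)
  then show ?thesis by blast
qed

text \<open>
  For \<open>d = 0\<close> the symbol of \<open>D\<^sub>p\<close> has \<open>a = b = 0\<close>, so each application lowers the degree in \<open>t\<close>.
\<close>

lemma D_poly_locally_nilpotent: "locally_nilpotent (D_poly h p)"
proof -
  let ?D = "D_poly h p"
  note D = D_poly(1)[of h p]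
  have c: "?D [:c:] = 0" for c
    using Der_Ah_const_top[OF D, of 0 c] degree_0_id[of "?D [:c:]"] by (simp add: D_poly)
  have "(?D ^^ n) f = 0" if "f = 0 \<or> degree f < n" for f n
    using that
  proof (induct n arbitrary: f)
    case (Suc n)
    show ?case
    proof (cases "degree f")
      case 0
      then have "?D f = 0" using c degree_0_id by metis
      with Suc(1)[of 0] show ?thesis by (simp add: funpow_Suc_right del: funpow.simps)
    next
      case (Suc m)
      have "degree (?D f) \<le> Suc m" and "coeff (?D f) (Suc m) = 0"
        using Der_Ah_top[OF D, of 0 f "Suc m"] D_poly(2,3)[of h p] Suc by auto
      hence "?D f = 0 \<or> degree (?D f) < Suc m"
        by (metis leading_coeff_0_iff le_neq_implies_less)
      with Suc.prems Suc.hyps[of "?D f"] Suc have "(?D ^^ n) (?D f) = 0" by auto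
      then show ?thesis by (simp add: funpow_Suc_right del: funpow.simps)
    qed
  qed simp
  hence "(?D ^^ Suc (degree f)) f = 0" for f by (metis lessI)
  moreover have "Suc n \<ge> 1" for n by simp
  ultimately show ?thesis unfolding locally_nilpotent_def by blast
qed


section \<open>Growth of leading monomials along the orbit of \<open>x\<close>\<close>

lemma degree_pderiv_le: "degree (pderiv p) \<le> degree p - 1"
  by (intro degree_le) (auto simp: coeff_pderiv coeff_eq_0)

lemma coeff_mult_top:
  fixes p q :: "'a::comm_semiring_0 poly"
  assumes "degree p \<le> m" "degree q \<le> n"
  shows "coeff (p * q) (m + n) = coeff p m * coeff q n"
proof -
  have zero: "coeff p i * coeff q (m + n - i) = 0" if "i \<noteq> m" for i
  proof (cases "i < m")
    case True
    then have "coeff q (m + n - i) = 0" using assms(2) by (intro coeff_eq_0) linarith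
    then show ?thesis by simp
  next
    case False
    with that have "coeff p i = 0" using assms(1) by (intro coeff_eq_0) linarith
    then show ?thesis by simp
  qed
  have "coeff (p * q) (m + n) = (\<Sum>i\<le>m + n. if i = m then coeff p m * coeff q n else 0)"
    unfolding coeff_mult by (intro sum.cong refl) (simp add: zero)
  then show ?thesis by simp
qed

text \<open>
  Let \<open>deg a = e + 1\<close> and \<open>deg h = \<eta> + 1\<close>.  The relation between \<open>a\<close> and \<open>b\<close> gives \<open>deg b \<le> e\<close> and
  \<open>(d + 1) \<beta> = (\<eta> - e) lc(a)\<close> for the coefficient \<open>\<beta>\<close> of \<open>x\<^sup>e\<close> in \<open>b\<close>.  Up to lower terms the monomial
  \<open>x\<^sup>m\<^sup>+\<^sup>1 t\<^sup>j\<close> is therefore sent to \<open>x\<^sup>m\<^sup>+\<^sup>1\<^sup>+\<^sup>e t\<^sup>j\<^sup>+\<^sup>d\<close> with the factor \<open>(m + 1) lc(a) + j \<beta>\<close>.  On the orbit of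
  \<open>x\<close> one has \<open>m = n e\<close> and \<open>j = n d\<close>, and \<open>d + 1\<close> times the factor is \<open>(1 + d + n e + n d \<eta>) lc(a)\<close>,
  where the integer is positive.
\<close>

lemma Der_Ah_growth:
  fixes h :: "'k::field_char_0 poly"
  assumes D: "D \<in> Der_Ah h" and x: "degree (D Ah_x) \<le> d" and t: "degree (D Ah_t) \<le> Suc d"
    and h: "degree h \<ge> 1" and a: "coeff (D Ah_x) d = a" "degree a = Suc e"
  shows "coeff (coeff ((D ^^ n) Ah_x) (n * d)) (Suc (n * e)) \<noteq> 0"
proof -
  define b where "b = coeff (D Ah_t) (Suc d)"
  define \<beta> where "\<beta> = coeff b e"
  have rel: "of_nat (Suc d) * b * h = a * pderiv h - h * pderiv a"
    using Der_Ah_top_relation[OF D x t] a(1) by (simp add: b_def algebra_simps)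
  have a0: "lead_coeff a \<noteq> 0" and h0: "lead_coeff h \<noteq> 0" using a(2) h
    by (metis degree_0 leading_coeff_0_iff nat.distinct(1),
        metis degree_0 leading_coeff_0_iff not_one_le_zero)
  have "h \<noteq> 0" using h by auto
  obtain \<eta> where \<eta>: "degree h = Suc \<eta>" using h by (metis Suc_le_D One_nat_def)
  have deg_b: "degree b \<le> e"
  proof (cases "b = 0")
    case False
    hence "degree (of_nat (Suc d) * b * h) = degree b + Suc \<eta>"
      using \<open>h \<noteq> 0\<close> \<eta> by (simp add: degree_mult_eq of_nat_poly del: of_nat_Suc)
    moreover have "degree (a * pderiv h - h * pderiv a) \<le> Suc e + \<eta>"
      using a(2) \<eta> by (intro degree_diff_le degree_mult_le[THEN le_trans])
        (simp_all add: degree_pderiv)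
    ultimately show ?thesis using rel by simp
  qed simp
  have key: "of_nat (Suc d) * \<beta> = (of_nat (Suc \<eta>) - of_nat (Suc e)) * lead_coeff a"
  proof -
    have "coeff (of_nat (Suc d) * b * h) (e + Suc \<eta>) = of_nat (Suc d) * (\<beta> * lead_coeff h)"
      using coeff_mult_top[OF deg_b, of h "Suc \<eta>"] \<eta>
      by (simp add: \<beta>_def of_nat_poly mult.assoc del: of_nat_Suc)
    moreover have "coeff (a * pderiv h) (e + Suc \<eta>) = of_nat (Suc \<eta>) * lead_coeff a * lead_coeff h"
      using coeff_mult_top[of a "Suc e" "pderiv h" \<eta>] a(2) \<eta>
      by (simp add: degree_pderiv coeff_pderiv del: of_nat_Suc)
    moreover have "coeff (h * pderiv a) (e + Suc \<eta>) = of_nat (Suc e) * lead_coeff a * lead_coeff h"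
      using coeff_mult_top[of h "Suc \<eta>" "pderiv a" e] a(2) \<eta>
      by (simp add: degree_pderiv coeff_pderiv add.commute del: of_nat_Suc)
    ultimately have "of_nat (Suc d) * \<beta> * lead_coeff h =
        (of_nat (Suc \<eta>) - of_nat (Suc e)) * lead_coeff a * lead_coeff h"
      using arg_cong[OF rel, of "\<lambda>p. coeff p (e + Suc \<eta>)"]
      by (simp only: coeff_diff) (simp add: algebra_simps del: of_nat_Suc)
    with h0 show ?thesis by simp
  qed
  have "degree ((D ^^ n) Ah_x) \<le> n * d \<and>
    degree (coeff ((D ^^ n) Ah_x) (n * d)) \<le> Suc (n * e) \<and>
    coeff (coeff ((D ^^ n) Ah_x) (n * d)) (Suc (n * e)) \<noteq> 0"
  proof (induct n)
    case 0
    show ?case by (simp add: Ah_x_def)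
  next
    case (Suc n)
    define F where "F = (D ^^ n) Ah_x"
    define f where "f = coeff F (n * d)"
    define m where "m = n * e"
    define \<phi> where "\<phi> = coeff f (Suc m)"
    have F: "degree F \<le> n * d" and f: "degree f \<le> Suc m" and \<phi>: "\<phi> \<noteq> 0"
      using Suc by (simp_all add: F_def f_def m_def \<phi>_def)
    have DF: "degree (D F) \<le> n * d + d"
      "coeff (D F) (n * d + d) = a * pderiv f + of_nat (n * d) * b * f"
      using Der_Ah_top[OF D x t F] by (simp_all add: a(1) b_def f_def)
    have deg: "degree (a * pderiv f + of_nat (n * d) * b * f) \<le> e + Suc m"
      using f a(2) deg_b
      by (intro degree_add_le degree_mult_le[THEN le_trans])
        (auto simp: degree_pderiv of_nat_poly intro!: add_mono degree_smult_le[THEN le_trans])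
    have 1: "coeff (a * pderiv f) (e + Suc m) = lead_coeff a * (of_nat (Suc m) * \<phi>)"
      using coeff_mult_top[of a "Suc e" "pderiv f" m] a(2) f
      by (simp add: degree_pderiv coeff_pderiv \<phi>_def del: of_nat_Suc)
    have 2: "coeff (of_nat (n * d) * b * f) (e + Suc m) = of_nat (n * d) * (\<beta> * \<phi>)"
      using coeff_mult_top[OF deg_b f]
      by (simp add: \<beta>_def \<phi>_def of_nat_poly mult.assoc del: of_nat_mult)
    have "of_nat (Suc d) * coeff (a * pderiv f + of_nat (n * d) * b * f) (e + Suc m) =
        \<phi> * (of_nat (Suc m) * of_nat (Suc d) * lead_coeff a + of_nat (n * d) * (of_nat (Suc d) * \<beta>))"
      unfolding coeff_add 1 2 by (simp add: algebra_simps)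
    also have "\<dots> = \<phi> * lead_coeff a *
        (of_nat (Suc m) * of_nat (Suc d) + of_nat (n * d) * (of_nat (Suc \<eta>) - of_nat (Suc e)))"
      unfolding key by (simp add: algebra_simps)
    also have "of_nat (Suc m) * of_nat (Suc d) + of_nat (n * d) * (of_nat (Suc \<eta>) - of_nat (Suc e)) =
        (of_nat (Suc (d + n * e + n * d * \<eta>)) :: 'k)"
      by (simp add: m_def algebra_simps)
    also have "\<phi> * lead_coeff a * \<dots> \<noteq> 0" using \<phi> a0 by (simp del: of_nat_Suc)
    finally have "coeff (a * pderiv f + of_nat (n * d) * b * f) (e + Suc m) \<noteq> 0" by auto
    with DF deg show ?case by (simp add: F_def m_def add.commute)
  qed
  then show ?thesis by blast
qed

text \<open>
  If \<open>deg a \<ge> 1\<close>, then bounded orbits force \<open>n d\<close> and \<open>n (deg a - 1)\<close> to be bounded in \<open>n\<close>.  If \<open>a\<close> is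
  constant, then comparing degrees in \<open>(d + 1) b h = a h'\<close> gives \<open>a = b = 0\<close>, and minimality of
  \<open>d\<close> leaves \<open>d = 0\<close>.
\<close>

theorem locally_finite_imp_degree_le_1:
  fixes h :: "'k::field_char_0 poly"
  assumes D: "D \<in> Der_Ah h" and lf: "locally_finite Ah_scale D" and h: "degree h \<ge> 1"
  shows "\<exists>a. D Ah_x = [:a:] \<and> degree a \<le> 1 \<and> h dvd a * pderiv h"
proof -
  \<comment> \<open>The truncated subtraction makes \<open>d = 0\<close> when \<open>D\<close> lowers the degree in \<open>t\<close>.\<close>
  define d where "d = max (degree (D Ah_x)) (degree (D Ah_t) - 1)"
  have x: "degree (D Ah_x) \<le> d" and t: "degree (D Ah_t) \<le> Suc d" by (auto simp: d_def)
  define a where "a = coeff (D Ah_x) d"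
  define b where "b = coeff (D Ah_t) (Suc d)"
  have rel: "of_nat (Suc d) * b * h + h * pderiv a = a * pderiv h"
    using Der_Ah_top_relation[OF D x t] by (simp add: a_def b_def)
  have h0: "h \<noteq> 0" using h by auto
  have d0: "d = 0 \<and> degree a \<le> 1"
  proof (cases "degree a")
    case 0
    then obtain c where c: "a = [:c:]" by (metis degree_0_id)
    have b0: "b = 0"
    proof (rule ccontr)
      assume "b \<noteq> 0"
      hence "degree h \<le> degree (of_nat (Suc d) * b * h)"
        using h0 by (simp add: degree_mult_eq of_nat_poly del: of_nat_Suc)
      also have "of_nat (Suc d) * b * h = smult c (pderiv h)"
        using rel c by (simp add: pderiv_pCons)
      also have "degree (smult c (pderiv h)) \<le> degree h - 1"
        by (metis degree_pderiv degree_smult_le)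
      finally show False using h by simp
    qed
    with rel c have "smult c (pderiv h) = 0" by (simp add: pderiv_pCons)
    moreover have "pderiv h \<noteq> 0" using h by (simp add: pderiv_eq_0_iff)
    ultimately have a0: "a = 0" using c by simp
    have "d = 0"
    proof (rule ccontr)
      assume d: "d \<noteq> 0"
      show False
      proof (cases "d = degree (D Ah_x)")
        case True
        with a0 d show False by (metis a_def degree_0 leading_coeff_0_iff)
      next
        case False
        with d have "degree (D Ah_t) = Suc d" by (auto simp: d_def)
        with b0 d show False by (metis b_def degree_0 leading_coeff_0_iff nat.distinct(1))
      qed
    qed
    with a0 show ?thesis by simp
  next
    case (Suc e)
    obtain K where K: "(D ^^ n) Ah_x \<in> coeff_box K" for n
      using lf unfolding locally_finite_iff_bounded_orbits by blast
    have "Suc K * d \<le> K" "Suc (Suc K * e) \<le> K"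
      using K[of "Suc K"] Der_Ah_growth[OF D x t h a_def[symmetric] Suc, of "Suc K"]
      unfolding coeff_box_def by blast+
    then show ?thesis using Suc by (cases d; cases e) auto
  qed
  with x have "D Ah_x = [:a:]" by (simp add: a_def degree_0_id)
  moreover have "h dvd a * pderiv h"
    unfolding rel[symmetric] by simp
  ultimately show ?thesis using d0 by blast
qed


section \<open>Weight filtrations\<close>

text \<open>
  The filtration in which \<open>x\<close> has weight \<open>1\<close> and \<open>t\<close> has weight \<open>N\<close>.
\<close>

definition weight_le :: "nat \<Rightarrow> nat \<Rightarrow> 'k::field poly poly \<Rightarrow> bool" where
  "weight_le N M f \<longleftrightarrow> (\<forall>j. coeff f j \<noteq> 0 \<longrightarrow> degree (coeff f j) + N * j \<le> M)"

lemma weight_le_0 [simp]: "weight_le N M 0"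
  by (simp add: weight_le_def)

lemma weight_le_add:
  assumes "weight_le N M f" "weight_le N M g"
  shows "weight_le N M (f + g)"
  unfolding weight_le_def
proof (intro allI impI)
  fix j assume "coeff (f + g) j \<noteq> 0"
  hence "coeff f j \<noteq> 0 \<or> coeff g j \<noteq> 0" by auto
  hence "N * j \<le> M" using assms unfolding weight_le_def by fastforce
  moreover have "degree (coeff f j) \<le> M - N * j" "degree (coeff g j) \<le> M - N * j"
    using assms unfolding weight_le_def by (cases "coeff f j = 0"; cases "coeff g j = 0"; fastforce)+
  ultimately show "degree (coeff (f + g) j) + N * j \<le> M"
    using degree_add_le[of "coeff f j" "M - N * j" "coeff g j"] by simp
qed

lemma all_nat_iff: "(\<forall>n. P n) \<longleftrightarrow> P 0 \<and> (\<forall>n. P (Suc n))"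
  by (metis not0_implies_Suc)

lemma weight_le_pCons:
  "weight_le N M (pCons c f) \<longleftrightarrow>
     (c \<noteq> 0 \<longrightarrow> degree c \<le> M) \<and> (f \<noteq> 0 \<longrightarrow> N \<le> M \<and> weight_le N (M - N) f)"
proof -
  have "weight_le N M (pCons c f) \<longleftrightarrow> (c \<noteq> 0 \<longrightarrow> degree c \<le> M) \<and>
      (\<forall>j. coeff f j \<noteq> 0 \<longrightarrow> degree (coeff f j) + N * Suc j \<le> M)"
    unfolding weight_le_def by (subst all_nat_iff) (simp add: coeff_pCons)
  also have "(\<forall>j. coeff f j \<noteq> 0 \<longrightarrow> degree (coeff f j) + N * Suc j \<le> M) \<longleftrightarrow>
      (f \<noteq> 0 \<longrightarrow> N \<le> M \<and> weight_le N (M - N) f)"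
  proof (cases "f = 0")
    case False
    then obtain j where "coeff f j \<noteq> 0" by (metis leading_coeff_0_iff)
    then show ?thesis using False unfolding weight_le_def by fastforce
  qed simp
  finally show ?thesis .
qed

lemma weight_le_smult:
  assumes "weight_le N M f" "p \<noteq> 0 \<Longrightarrow> degree p \<le> e"
  shows "weight_le N (e + M) (smult p f)"
  unfolding weight_le_def
proof (intro allI impI)
  fix j assume "coeff (smult p f) j \<noteq> 0"
  hence "p \<noteq> 0" "coeff f j \<noteq> 0" by auto
  with assms show "degree (coeff (smult p f) j) + N * j \<le> e + M"
    using degree_mult_le[of p "coeff f j"] unfolding weight_le_def by fastforce
qed

text \<open>
  Moving \<open>t\<close> past \<open>x\<^sup>i\<close> produces \<open>i x\<^sup>i\<^sup>-\<^sup>1 h\<close>; the condition \<open>deg h \<le> N\<close> keeps this below the weight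
  \<open>i + N\<close> of \<open>x\<^sup>i t\<close>.
\<close>

lemma weight_le_t_mult:
  assumes "weight_le N M f" "degree h \<le> N"
  shows "weight_le N (N + M) (ore_t_mult (poly_der h) f)"
proof -
  have "weight_le N (N + M) (map_poly (poly_der h) f)"
    unfolding weight_le_def
  proof (intro allI impI)
    fix j assume "coeff (map_poly (poly_der h) f) j \<noteq> 0"
    hence "coeff f j \<noteq> 0" by (auto simp: coeff_map_poly)
    with assms show "degree (coeff (map_poly (poly_der h) f) j) + N * j \<le> N + M"
      using degree_mult_le[of h "pderiv (coeff f j)"] degree_pderiv_le[of "coeff f j"]
      unfolding weight_le_def by (fastforce simp: coeff_map_poly poly_der_def)
  qed
  with assms(1) show ?thesis
    by (simp add: ore_t_mult_def weight_le_add weight_le_pCons)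
qed

lemma weight_le_mult:
  assumes "weight_le N M f" "weight_le N L g" "degree h \<le> N"
  shows "weight_le N (M + L) (Ah_mult h f g)"
  using assms(1,2) unfolding Ah_mult_def
proof (induct f arbitrary: M L g)
  case (pCons c f)
  have "weight_le N (M + L) (ore_mult (poly_der h) f (ore_t_mult (poly_der h) g))"
  proof (cases "f = 0")
    case False
    with pCons(3) have "N \<le> M" "weight_le N (M - N) f" by (simp_all add: weight_le_pCons)
    with pCons(2)[of "M - N" "N + L"] weight_le_t_mult[OF pCons(4) assms(3)] show ?thesis by simp
  qed simp
  moreover have "weight_le N (M + L) (smult c g)"
    using weight_le_smult[OF pCons(4), of c M] pCons(3) by (simp add: weight_le_pCons)
  ultimately show ?case by (simp add: ore_mult_pCons weight_le_add)
qed simp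

lemma weight_le_imp_coeff_box:
  assumes "weight_le N M f" "N \<ge> 1"
  shows "f \<in> coeff_box M"
proof -
  have "j \<le> M \<and> i \<le> M" if "coeff (coeff f j) i \<noteq> 0" for i j
  proof -
    from that have "coeff f j \<noteq> 0" "i \<le> degree (coeff f j)" by (auto simp: le_degree)
    with assms(1) have "i + N * j \<le> M" unfolding weight_le_def by fastforce
    moreover have "1 * j \<le> N * j" using assms(2) by (rule mult_le_mono1)
    ultimately show ?thesis by linarith
  qed
  then show ?thesis by (simp add: coeff_box_def)
qed

lemma ex_weight_le: "\<exists>M. weight_le N M f"
proof (induct f)
  case (pCons c f)
  then obtain M where "weight_le N M f" by blast
  hence "weight_le N (degree c + N + M) (pCons c f)"
    by (auto simp: weight_le_def coeff_pCons split: nat.split)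
  then show ?case by blast
qed simp

text \<open>
  Choosing the weight of \<open>t\<close> above both \<open>deg h\<close> and \<open>deg p\<close> makes \<open>D\<close> raise the weight of neither
  generator, so it preserves every step of the filtration.
\<close>

theorem affine_Der_Ah_locally_finite:
  fixes h :: "'k::field poly"
  assumes D: "D \<in> Der_Ah h" and x: "D Ah_x = [:a:]" "degree a \<le> 1"
    and t: "D Ah_t = [:p, [:\<beta>:]:]"
  shows "locally_finite Ah_scale D"
proof -
  define N where "N = Suc (degree h + degree p)"
  have Dt: "weight_le N N (D Ah_t)"
    unfolding t weight_le_def by (auto simp: N_def coeff_pCons split: nat.splits)
  have Dc: "D [:c:] = [:a * pderiv c:]" for c
    using Der_Ah_const_top[OF D, of 0 c] degree_0_id[of "D [:c:]"] by (simp add: x)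
  have step: "weight_le N M (D f)" if "weight_le N M f" for M f
    using that
  proof (induct f arbitrary: M)
    case 0
    then show ?case by (simp add: Der_Ah_zero[OF D])
  next
    case (pCons c f)
    have 1: "weight_le N M (D [:c:])"
    proof (cases "degree c = 0")
      case True
      then obtain e where "c = [:e:]" by (metis degree_0_id)
      then show ?thesis by (simp add: Dc pderiv_pCons)
    next
      case False
      then show ?thesis
        using pCons(3) x(2) degree_mult_le[of a "pderiv c"] degree_pderiv_le[of c]
        by (auto simp: Dc weight_le_pCons)
    qed
    have 2: "weight_le N M (pCons 0 (D f) + Ah_mult h f (D Ah_t))"
    proof (cases "f = 0")
      case True
      then show ?thesis by (simp add: Der_Ah_zero[OF D] Ah_mult_def)
    next
      case False
      with pCons(3) have f: "N \<le> M" "weight_le N (M - N) f" by (simp_all add: weight_le_pCons)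
      then have "weight_le N M (pCons 0 (D f))" using pCons(2) by (simp add: weight_le_pCons)
      moreover have "weight_le N M (Ah_mult h f (D Ah_t))"
        using weight_le_mult[OF f(2) Dt, of h] f(1) by (simp add: N_def)
      ultimately show ?thesis by (rule weight_le_add)
    qed
    show ?case
      unfolding Der_Ah_pCons[OF D, of c f] add.assoc by (rule weight_le_add[OF 1 2])
  qed
  show ?thesis
    unfolding locally_finite_iff_bounded_orbits
  proof
    fix f :: "'k poly poly"
    obtain M where M: "weight_le N M f" using ex_weight_le by blast
    have "weight_le N M ((D ^^ n) f)" for n by (induct n) (simp_all add: M step)
    then show "\<exists>K. \<forall>n. (D ^^ n) f \<in> coeff_box K"
      using weight_le_imp_coeff_box[of N M] by (auto simp: N_def)
  qed
qed


section \<open>The derivation \<open>E\<^sub>t\<close>\<close>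

lemma fract_poly_E_t:
  assumes "\<psi> dvd h" "\<psi> dvd pderiv h" "\<psi> \<noteq> 0"
  shows "fract_poly (E_t h \<psi> f) =
    ore_commutator (fract_der h) [:0, inverse (to_fract \<psi>):] (fract_poly f)"
  unfolding E_t_def by (rule theI'[OF E_t_unique_existence[OF assms]])

text \<open>
  The polynomial \<open>k = g \<psi>' / \<psi>\<close> arises from \<open>[\<psi>\<^sup>-\<^sup>1 t, t] = - h (\<psi>\<^sup>-\<^sup>1)' t = (h \<psi>' / \<psi>\<^sup>2) t\<close>.
\<close>

lemma E_t_properties:
  assumes \<psi>: "\<psi> dvd h" "\<psi> dvd pderiv h" "\<psi> \<noteq> 0" and g: "h = \<psi> * g"
    and k: "g * pderiv \<psi> = \<psi> * k"
  shows "E_t h \<psi> \<in> Der_Ah h" "E_t h \<psi> Ah_x = [:g:]" "E_t h \<psi> Ah_t = [:0, k:]"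
proof -
  let ?u = "[:0, inverse (to_fract \<psi>):]"
  note E = fract_poly_E_t[OF \<psi>]
  have nz: "to_fract \<psi> \<noteq> 0" using \<psi>(3) by simp
  have "fract_der h (inverse (to_fract \<psi>)) = Fract (- (h * pderiv \<psi>)) (\<psi> * \<psi>)"
    using \<psi>(3) by (simp add: to_fract_def fract_der_Fract)
  also have "h * pderiv \<psi> = k * (\<psi> * \<psi>)"
    using k by (simp add: g mult.assoc mult.commute)
  finally have inv: "fract_der h (inverse (to_fract \<psi>)) = - to_fract k"
    using \<psi>(3) by (simp add: to_fract_def eq_fract)
  show "E_t h \<psi> Ah_t = [:0, k:]"
    by (rule fract_poly_inj[THEN iffD1])
      (simp add: E Ah_t_def ore_commutator_def ore_mult_pCons fract_poly_pCons Kx.t_pCons inv nz)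
  have x: "inverse (to_fract \<psi>) * to_fract h = to_fract g"
    "fract_der h (to_fract [:0, 1:]) = to_fract h"
    using nz by (simp_all add: g) (simp add: fract_der_to_fract poly_der_def pderiv_pCons)
  show "E_t h \<psi> Ah_x = [:g:]"
    by (rule fract_poly_inj[THEN iffD1])
      (simp add: E Ah_x_def ore_commutator_def ore_mult_pCons fract_poly_pCons Kx.t_pCons
        mult.commute x[unfolded mult.commute[of "inverse _"]])
  have add: "E_t h \<psi> (a + b) = E_t h \<psi> a + E_t h \<psi> b" for a b
    by (rule fract_poly_inj[THEN iffD1]) (simp add: E Kx.commutator_add)
  have mult: "E_t h \<psi> (Ah_mult h a b) = Ah_mult h (E_t h \<psi> a) b + Ah_mult h a (E_t h \<psi> b)" for a b
    by (rule fract_poly_inj[THEN iffD1]) (simp add: E fract_poly_Ah_mult Kx.commutator_mult)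
  have const: "fract_der h (to_fract [:c:]) = 0" for c
    by (simp add: fract_der_to_fract poly_der_def pderiv_pCons)
  have scalar: "E_t h \<psi> [:[:c:]:] = 0" for c
    by (rule fract_poly_inj[THEN iffD1])
      (simp add: E ore_commutator_def ore_mult_pCons fract_poly_pCons Kx.t_pCons mult.commute const)
  have "Ah_scale c a = Ah_mult h [:[:c:]:] a" for c a
    by (simp add: Ah_scale_def Ah_mult_def)
  hence "E_t h \<psi> (Ah_scale c a) = Ah_scale c (E_t h \<psi> a)" for c a
    by (simp only: mult scalar) (simp add: Ah_mult_def)
  with add mult show "E_t h \<psi> \<in> Der_Ah h" by (simp add: Der_Ah_iff)
qed

lemma Der_Ah_add_scale:
  assumes "D \<in> Der_Ah h" "E \<in> Der_Ah h"
  shows "(\<lambda>f. Ah_scale c (D f) + E f) \<in> Der_Ah h"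
proof -
  have "Ah_mult h (a + b) f = Ah_mult h a f + Ah_mult h b f"
    "Ah_mult h f (a + b) = Ah_mult h f a + Ah_mult h f b" for a b f
    by (simp_all add: Ah_mult_def ore_mult_add_left Ah.mult_add_right)
  then show ?thesis
    using assms
    by (simp add: Der_Ah_iff Ah_scale_mult_left Ah_scale_mult_right Ah_vs.scale_right_distrib
        mult.commute algebra_simps)
qed


section \<open>Divisibility by \<open>h / \<psi>\<close> and the classification\<close>

text \<open>
  The Euclidean algorithm: if \<open>q a = p c\<close> then \<open>q\<close> divides \<open>(p mod q) c\<close>, so by the claim for the
  smaller pair \<open>(q, p mod q)\<close> it divides \<open>c\<close> and can be cancelled.
\<close>

lemma coprime_dvd_mult_euclidean:
  fixes p q a :: "'a::euclidean_ring"
  assumes "coprime p q" "p dvd q * a"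
  shows "p dvd a"
  using assms
proof (induct "euclidean_size q" arbitrary: p q a rule: less_induct)
  case less
  show ?case
  proof (cases "q = 0")
    case True
    with less.prems(1) have "p dvd 1" by simp
    then show ?thesis by (rule dvd_trans) simp
  next
    case False
    obtain c where c: "q * a = p * c" using less.prems(2) by blast
    have "coprime q (p mod q)"
      using less.prems(1) False by (simp add: coprime_commute)
    moreover have "(p mod q) * c = q * (a - p div q * c)"
      using c by (simp add: algebra_simps flip: minus_div_mult_eq_mod)
    hence "q dvd (p mod q) * c" by simp
    ultimately have "q dvd c" using less.hyps[of "p mod q" q c] False mod_size_less by blast
    then obtain e where "c = q * e" by blast
    with c False have "a = p * e" by (simp add: mult.left_commute)
    then show ?thesis by simp
  qed
qed

lemma div_gcd_dvd:
  fixes h k \<psi> g a :: "'k::field poly"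
  assumes h: "h \<noteq> 0" and \<psi>: "is_gcd \<psi> h k" and g: "h = \<psi> * g" and dvd: "h dvd a * k"
  shows "g dvd a"
proof -
  obtain r where r: "k = \<psi> * r" using \<psi> by (auto simp: is_gcd_def)
  have \<psi>0: "\<psi> \<noteq> 0" using h g by auto
  have "coprime g r"
  proof (rule coprimeI)
    fix c assume "c dvd g" "c dvd r"
    hence "\<psi> * c dvd h" "\<psi> * c dvd k" using g r by (simp_all add: mult_dvd_mono)
    hence "\<psi> * c dvd \<psi> * 1" using \<psi> by (simp add: is_gcd_def)
    then show "c dvd 1" using \<psi>0 by (simp only: dvd_mult_cancel_left) simp
  qed
  moreover have "\<psi> * g dvd \<psi> * (r * a)" using dvd by (simp add: g r mult_ac)
  hence "g dvd r * a" using \<psi>0 by (simp only: dvd_mult_cancel_left) simp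
  ultimately show ?thesis by (rule coprime_dvd_mult_euclidean)
qed

theorem theorem19:
  fixes h \<psi> g :: "'k::{alg_closed_field, field_char_0} poly"
  assumes "degree h \<ge> 1"
    and "is_gcd \<psi> h (pderiv h)"
    and "\<psi> \<notin> range (\<lambda>c. [:c:])"
    and "g = h div \<psi>"
  shows "(degree g \<ge> 2 \<longrightarrow>
      (\<forall>D\<in>Der_Ah h. locally_finite Ah_scale D \<longleftrightarrow> (\<exists>p. D = D_poly h p)) \<and>
      (\<forall>D\<in>Der_Ah h. locally_finite Ah_scale D \<longleftrightarrow> locally_nilpotent D)) \<and>
    (degree g = 1 \<longrightarrow>
      (\<forall>D\<in>Der_Ah h. locally_finite Ah_scale D \<longleftrightarrow>
        (\<exists>c p. D = (\<lambda>f. Ah_scale c (E_t h \<psi> f) + D_poly h p f))))"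
proof -
  have h0: "h \<noteq> 0" using assms(1) by auto
  have \<psi>: "\<psi> dvd h" "\<psi> dvd pderiv h" using assms(2) by (auto simp: is_gcd_def)
  have \<psi>0: "\<psi> \<noteq> 0" using \<psi>(1) h0 by auto
  have g: "h = \<psi> * g" using \<psi>(1) assms(4) by simp
  have "\<psi> dvd g * pderiv \<psi>"
    using \<psi>(2) unfolding g pderiv_mult by (simp add: dvd_add_right_iff)
  then obtain k where k: "g * pderiv \<psi> = \<psi> * k" by blast
  note E = E_t_properties[OF \<psi> \<psi>0 g k]
  have nilp: "locally_finite Ah_scale D" if "D \<in> Der_Ah h" "locally_nilpotent D" for D
    using that locally_nilpotent_imp_locally_finite Der_Ah_zero by blast
  have lf: "\<exists>a. D Ah_x = [:a * g:] \<and> degree (a * g) \<le> 1"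
    if "D \<in> Der_Ah h" "locally_finite Ah_scale D" for D
    using locally_finite_imp_degree_le_1[OF that assms(1)] div_gcd_dvd[OF h0 assms(2) g]
    by (metis dvd_def mult.commute)
  have D_poly_iff: "locally_finite Ah_scale D \<longleftrightarrow> (\<exists>p. D = D_poly h p)"
    if g2: "degree g \<ge> 2" and D: "D \<in> Der_Ah h" for D
  proof
    assume "locally_finite Ah_scale D"
    with lf[OF D] obtain a where a: "D Ah_x = [:a * g:]" "degree (a * g) \<le> 1" by blast
    have "a = 0"
    proof (rule ccontr)
      assume "a \<noteq> 0"
      hence "degree (a * g) = degree a + degree g" using g2 by (intro degree_mult_eq) auto
      with a(2) g2 show False by simp
    qed
    with a Der_Ah_eq_D_poly[OF D h0] show "\<exists>p. D = D_poly h p" by simp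
  qed (use nilp D_poly(1) D_poly_locally_nilpotent in blast)
  have E_t_iff: "locally_finite Ah_scale D \<longleftrightarrow>
      (\<exists>c p. D = (\<lambda>f. Ah_scale c (E_t h \<psi> f) + D_poly h p f))"
    if g1: "degree g = 1" and D: "D \<in> Der_Ah h" for D
  proof
    assume "locally_finite Ah_scale D"
    with lf[OF D] obtain a where a: "D Ah_x = [:a * g:]" "degree (a * g) \<le> 1" by blast
    have "degree a = 0" using a(2) g1 degree_mult_eq[of a g] by (cases "a = 0"; cases "g = 0") auto
    then obtain c where c: "a = [:c:]" by (metis degree_0_id)
    let ?D' = "\<lambda>f. Ah_scale (- c) (E_t h \<psi> f) + D f"
    have "?D' \<in> Der_Ah h" by (rule Der_Ah_add_scale[OF E(1) D])
    moreover have "?D' Ah_x = 0" by (simp add: a c E Ah_scale_def)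
    ultimately obtain p where "?D' = D_poly h p" using Der_Ah_eq_D_poly[OF _ h0] by blast
    hence "D_poly h p f = D f - Ah_scale c (E_t h \<psi> f)" for f
      by (metis Ah_vs.scale_minus_left uminus_add_conv_diff)
    hence "D = (\<lambda>f. Ah_scale c (E_t h \<psi> f) + D_poly h p f)" by (simp add: fun_eq_iff)
    then show "\<exists>c p. D = (\<lambda>f. Ah_scale c (E_t h \<psi> f) + D_poly h p f)" by blast
  next
    assume "\<exists>c p. D = (\<lambda>f. Ah_scale c (E_t h \<psi> f) + D_poly h p f)"
    then obtain c p where Dcp: "D = (\<lambda>f. Ah_scale c (E_t h \<psi> f) + D_poly h p f)" by blast
    \<comment> \<open>\<open>deg \<psi> + deg k = deg g + deg \<psi>'\<close>, and \<open>deg \<psi>' \<le> deg \<psi> - 1\<close> as \<open>\<psi>\<close> is not constant.\<close>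
    have "degree k = 0"
    proof (cases "k = 0")
      case False
      hence "degree \<psi> + degree k = degree (g * pderiv \<psi>)" using \<psi>0 k by (simp add: degree_mult_eq)
      also have "\<dots> \<le> 1 + (degree \<psi> - 1)"
        using degree_mult_le[of g "pderiv \<psi>"] g1 degree_pderiv_le[of \<psi>] by simp
      finally show ?thesis 
        using assms(3) degree_0_id[of \<psi>] by (cases "degree \<psi>") (auto, metis rangeI)
    qed simp
    then obtain \<beta> where \<beta>: "k = [:\<beta>:]" by (metis degree_0_id)
    show "locally_finite Ah_scale D"
    proof (rule affine_Der_Ah_locally_finite[OF D])
      show "D Ah_x = [:smult c g:]" by (simp add: Dcp E D_poly Ah_scale_def)
      show "degree (smult c g) \<le> 1" using g1 degree_smult_le[of c g] by simp
      show "D Ah_t = [:p, [:c * \<beta>:]:]" by (simp add: Dcp E D_poly Ah_scale_def \<beta>)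
    qed
  qed
  have "locally_finite Ah_scale D \<longleftrightarrow> locally_nilpotent D"
    if "degree g \<ge> 2" "D \<in> Der_Ah h" for D
    using D_poly_iff[OF that] nilp[OF that(2)] D_poly_locally_nilpotent by blast
  with D_poly_iff E_t_iff show ?thesis by blast
qed

end
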